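(* Let $N\ge 2$ be an integer, let $0<\delta<\ell$ be real numbers, and let $T\in\mathbb{R}^{2N\times 2N}$ be the iteration matrix of the one-level parallel Schwarz method for the one-dimensional Laplace equation with $N$ subdomains of length $\ell$ and overlap $\delta$ (the explicit block matrix defined in the context). Let $\mathbf{1}_N\in\mathbb{R}^{2N}$ be the vector whose entries are all equal to $1$, and let $\|\cdot\|$ denote the infinity norm on $\mathbb{R}^{2N}$ and also the induced matrix norm. Then for every $n\in\mathbb{N}$, $n \geq 1$, $$\|T^n\|=\|T^n\mathbf{1}_N\|\le 1,$$ and moreover: (a) $\|T^{\lceil N/2\rceil}\|<1$, and hence $\rho(T)<1$, where $\rho(T)$ is the spectral radius of $T$. (b) For every integer $n\ge\lceil N/2\rceil$: if $N$ is even then $\|T^{n+1}\|<\|T^n\|$, and if $N$ is odd then $\|T^{n+2}\|<\|T^n\|$.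
   Context: The matrix $T\in\mathbb{R}^{2N\times 2N}$ is an $N\times N$ block matrix with $2\times 2$ blocks, depending on $N$, $\delta$, $\ell$ as follows. Put $$T_1=\begin{bmatrix}0&1-\frac{\delta}{\ell}\\0&\frac{\delta}{\ell}\end{bmatrix},\quad \widetilde{T_1}=\begin{bmatrix}0&1-\frac{\delta}{\ell}\\0&0\end{bmatrix},\quad T_2=\begin{bmatrix}\frac{\delta}{\ell}&0\\1-\frac{\delta}{\ell}&0\end{bmatrix},\quad \widetilde{T_2}=\begin{bmatrix}0&0\\1-\frac{\delta}{\ell}&0\end{bmatrix}.$$ Writing $\mathbf{v}\in\mathbb{R}^{2N}$ as $\mathbf{v}=(\mathbf{v}_1,\dots,\mathbf{v}_N)$ with $\mathbf{v}_j\in\mathbb{R}^2$, the matrix $T$ acts by $$(T\mathbf{v})_1=\widetilde{T_2}\,\mathbf{v}_2,\qquad (T\mathbf{v})_j=T_1\mathbf{v}_{j-1}+T_2\mathbf{v}_{j+1}\ \ (2\le j\le N-1),\qquad (T\mathbf{v})_N=\widetilde{T_1}\,\mathbf{v}_{N-1}.$$ That is, $T$ is block tridiagonal with zero diagonal blocks; the first block row has $\widetilde{T_2}$ in block column $2$, block row $j$ ($2\le j\le N-1$) has $T_1$ in block column $j-1$ and $T_2$ in block column $j+1$, and the last block row has $\widetilde{T_1}$ in block column $N-1$. Origin of $T$ (not needed for the statement): for $e''=0$ on $(0,L)$, $e(0)=e(L)=0$, with $L=N\ell-(N-1)\delta$ and subdomains $\Omega_j=(a_j,b_j)$, $a_j=(j-1)(\ell-\delta)$,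 $b_j=a_j+\ell$, the parallel Schwarz iterates $e_j^n$ (harmonic on $\Omega_j$ with $e^n_j(a_j)=e^{n-1}_{j-1}(a_j)$, $e^n_j(b_j)=e^{n-1}_{j+1}(b_j)$ and zero values at $0$ and $L$) satisfy $\mathbf{e}^{n+1}=T\mathbf{e}^n$, where the blocks of $\mathbf{e}^n$ are $(e_1^n(a_1),e_1^n(a_2))$, $(e_j^n(b_{j-1}),e_j^n(a_{j+1}))$ for $2\le j\le N-1$, and $(e_N^n(b_{N-1}),e_N^n(b_N))$. *)

theory Defs
  imports "Jordan_Normal_Form.Spectral_Radius"
begin

definition linf_norm_vec :: "real vec \<Rightarrow> real" where
  "linf_norm_vec v = Max ((\<lambda>i. \<bar>v $ i\<bar>) ` {..<dim_vec v})"

definition linf_norm_mat :: "real mat \<Rightarrow> real" where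
  "linf_norm_mat A =
     Sup {linf_norm_vec (A *\<^sub>v v) / linf_norm_vec v | v.
            v \<in> carrier_vec (dim_col A) \<and> v \<noteq> 0\<^sub>v (dim_col A)}"

definition T1 :: "real \<Rightarrow> real \<Rightarrow> real mat" where
  "T1 \<delta> l = mat_of_rows_list 2
     [[0, 1 - \<delta> / l],
      [0, \<delta> / l]]"

definition T1_tilde :: "real \<Rightarrow> real \<Rightarrow> real mat" where
  "T1_tilde \<delta> l = mat_of_rows_list 2
     [[0, 1 - \<delta> / l],
      [0, 0]]"

definition T2 :: "real \<Rightarrow> real \<Rightarrow> real mat" where
  "T2 \<delta> l = mat_of_rows_list 2
     [[\<delta> / l, 0],
      [1 - \<delta> / l, 0]]"

definition T2_tilde :: "real \<Rightarrow> real \<Rightarrow> real mat" where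
  "T2_tilde \<delta> l = mat_of_rows_list 2
     [[0, 0],
      [1 - \<delta> / l, 0]]"

(* Block rows and columns are numbered 0, ..., N - 1; the order of the cases
   gives the boundary rows precedence over the interior ones (N \<ge> 2). *)
definition schwarz_block :: "nat \<Rightarrow> real \<Rightarrow> real \<Rightarrow> nat \<Rightarrow> nat \<Rightarrow> real mat" where
  "schwarz_block N \<delta> l i j =
     (if i = 0 then (if j = 1 then T2_tilde \<delta> l else 0\<^sub>m 2 2)
      else if i = N - 1 then (if j + 1 = i then T1_tilde \<delta> l else 0\<^sub>m 2 2)
      else if j + 1 = i then T1 \<delta> l
      else if j = i + 1 then T2 \<delta> l
      else 0\<^sub>m 2 2)"

definition schwarz_T :: "nat \<Rightarrow> real \<Rightarrow> real \<Rightarrow> real mat" where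
  "schwarz_T N \<delta> l = mat (2 * N) (2 * N)
     (\<lambda>(r, c). schwarz_block N \<delta> l (r div 2) (c div 2) $$ (r mod 2, c mod 2))"

definition ones_vec :: "nat \<Rightarrow> real vec" where
  "ones_vec N = vec (2 * N) (\<lambda>_. 1)"

end

theory Submission
  imports Defs
begin

text \<open>
  Put \<open>p = \<delta> / l\<close>. Up to the two rows that vanish, \<open>T\<close> is the transition matrix of a walk with memory on
  the path \<open>1, \<dots>, N\<close>: with probability \<open>p\<close> it repeats its last direction and with probability
  \<open>1 - p\<close> it reverses it, and it is killed when it leaves the path. The entries of \<open>T\<^sup>n 1\<close>
  are the probabilities of surviving \<open>n\<close> moves, and since \<open>T \<ge> 0\<close> the largest of them is the norm
  of \<open>T\<^sup>n\<close>. The survival probability drops strictly from \<open>n\<close> to \<open>n + 1\<close> at every site from which an end of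
  the path can be reached in exactly \<open>n\<close> moves. For odd \<open>N\<close> and \<open>n \<ge> N / 2\<close> this
  happens at every site at time \<open>n\<close> or \<open>n + 1\<close>. For even \<open>N\<close> the parity fails only at sites whose far end
  is more than \<open>n\<close> moves away; there the survival probability of \<open>n + 1\<close> moves is strictly below that of
  \<open>n\<close> moves from the next site inwards.
\<close>

section \<open>Survival probabilities of the walk\<close>

text \<open>The walk has \<open>a\<close> sites ahead of it and \<open>b\<close> sites behind it, with respect to its last
  direction; using these instead of position and direction makes the reflection symmetry implicit.\<close>

fun survival :: "real \<Rightarrow> nat \<Rightarrow> nat \<Rightarrow> nat \<Rightarrow> real" where
  "survival p 0 a b = 1"
| "survival p (Suc n) a b =
     (if a = 0 then 0 else p * survival p n (a - 1) (Suc b)) +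
     (if b = 0 then 0 else (1 - p) * survival p n (b - 1) (Suc a))"

declare survival.simps(2) [simp del]

text \<open>The value after one move in the current direction, with \<open>0\<close> for a killed
  walk. A reversing move is the same function with the two distances exchanged, so comparing
  survival probabilities reduces to two comparisons of this shape.\<close>

definition survival_step :: "real \<Rightarrow> nat \<Rightarrow> nat \<Rightarrow> nat \<Rightarrow> real" where
  "survival_step p n a b = (if a = 0 then 0 else survival p n (a - 1) (Suc b))"

lemma survival_step_simps [simp]:
  "survival_step p n 0 b = 0"
  "survival_step p n (Suc a) b = survival p n a (Suc b)"
  by (simp_all add: survival_step_def)

lemma survival_Suc:
  "survival p (Suc n) a b = p * survival_step p n a b + (1 - p) * survival_step p n b a"
  by (simp add: survival.simps(2) survival_step_def)

context
  fixes p :: real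
  assumes p: "0 < p" "p < 1"
begin

lemma survival_Suc_leI:
  assumes "survival_step p m a b \<le> survival_step p n c d"
    and "survival_step p m b a \<le> survival_step p n d c"
  shows "survival p (Suc m) a b \<le> survival p (Suc n) c d"
  unfolding survival_Suc using assms p by (intro add_mono mult_left_mono) auto

lemma survival_Suc_lessI:
  assumes "survival_step p m a b \<le> survival_step p n c d"
    and "survival_step p m b a \<le> survival_step p n d c"
    and "survival_step p m a b < survival_step p n c d \<or>
         survival_step p m b a < survival_step p n d c"
  shows "survival p (Suc m) a b < survival p (Suc n) c d"
  using assms(3)
proof
  assume "survival_step p m a b < survival_step p n c d"
  then show ?thesis
    unfolding survival_Suc using assms p
    by (intro add_less_le_mono mult_strict_left_mono mult_left_mono) auto
next
  assume "survival_step p m b a < survival_step p n d c"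
  then show ?thesis
    unfolding survival_Suc using assms p
    by (intro add_le_less_mono mult_strict_left_mono mult_left_mono) auto
qed

lemma survival_nonneg: "0 \<le> survival p n a b"
  using p by (induction n arbitrary: a b) (auto simp: survival.simps(2))

text \<open>On a path with at least two sites some move stays inside, and moves preserve
  \<open>a + b\<close>.\<close>

lemma survival_pos: "0 < a + b \<Longrightarrow> 0 < survival p n a b"
proof (induction n arbitrary: a b)
  case (Suc n)
  have step_pos: "0 < survival_step p n (Suc a) b" for a b
    using Suc.IH by simp
  have step_nonneg: "0 \<le> survival_step p n a b" for a b
    by (simp add: survival_step_def survival_nonneg)
  from Suc.prems consider a' where "a = Suc a'" | b' where "b = Suc b'"
    by (cases a; cases b) auto
  then show ?case
  proof cases
    case 1
    then show ?thesis
      unfolding survival_Suc using step_pos step_nonneg p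
      by (intro add_pos_nonneg mult_pos_pos mult_nonneg_nonneg) auto
  next
    case 2
    then show ?thesis
      unfolding survival_Suc using step_pos step_nonneg p
      by (intro add_nonneg_pos mult_pos_pos mult_nonneg_nonneg) auto
  qed
qed simp

lemma survival_Suc_le: "survival p (Suc n) a b \<le> survival p n a b"
proof (induction n arbitrary: a b)
  case 0
  have "survival_step p 0 a b \<le> 1" for a b by (cases a) auto
  then have "survival p (Suc 0) a b \<le> p * 1 + (1 - p) * 1"
    unfolding survival_Suc using p by (intro add_mono mult_left_mono) auto
  then show ?case by simp
next
  case (Suc n)
  show ?case
    by (rule survival_Suc_leI) (simp_all add: survival_step_def Suc)
qed

lemma survival_antimono: "m \<le> n \<Longrightarrow> survival p n a b \<le> survival p m a b"
  by (rule lift_Suc_antimono_le[of "\<lambda>n. survival p n a b"]) (auto intro: survival_Suc_le)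

lemma survival_le_1: "survival p n a b \<le> 1"
  using survival_antimono[of 0 n a b] by simp

lemma survival_Suc_0_less_1: "a = 0 \<or> b = 0 \<Longrightarrow> survival p (Suc 0) a b < 1"
  using p by (auto simp: survival.simps)

text \<open>The walk leaves the path with positive probability by \<open>a + 1\<close> moves
  straight ahead, or by \<open>b + 1\<close> moves of which only the first reverses.\<close>

lemma survival_less_1: "a < n \<or> b < n \<Longrightarrow> survival p n a b < 1"
proof (induction n arbitrary: a b)
  case (Suc n)
  show ?case
  proof (cases "a = 0 \<or> b = 0")
    case True
    then show ?thesis
      using survival_Suc_0_less_1[OF True] survival_antimono[of "Suc 0" "Suc n" a b] by simp
  next
    case False
    then obtain a' b' where ab: "a = Suc a'" "b = Suc b'" by (cases a; cases b) auto
    then have "a' < n \<or> b' < n" using Suc.prems by simp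
    then have "survival p n a' (Suc b) < 1 \<or> survival p n b' (Suc a) < 1"
      using Suc.IH by blast
    then have "p * survival p n a' (Suc b) + (1 - p) * survival p n b' (Suc a) < p * 1 + (1 - p) * 1"
    proof
      assume "survival p n a' (Suc b) < 1"
      then show ?thesis
        using p survival_le_1
        by (intro add_less_le_mono mult_strict_left_mono mult_left_mono) auto
    next
      assume "survival p n b' (Suc a) < 1"
      then show ?thesis
        using p survival_le_1
        by (intro add_le_less_mono mult_strict_left_mono mult_left_mono) auto
    qed
    then show ?thesis using ab by (simp add: survival_Suc)
  qed
qed simp

text \<open>A walk that reaches the end of the path in exactly \<open>n\<close> moves is killed at
  move \<open>n + 1\<close> with positive probability.\<close>

lemma survival_Suc_less:
  assumes "0 < a + b" "(a \<le> n \<and> even (n + a)) \<or> (b \<le> n \<and> even (n + b))"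
  shows "survival p (Suc n) a b < survival p n a b"
  using assms
proof (induction n arbitrary: a b)
  case 0
  then show ?case using survival_Suc_0_less_1[of a b] by auto
next
  case (Suc n)
  have step_le: "survival_step p (Suc n) a b \<le> survival_step p n a b" for a b
    by (simp add: survival_step_def survival_Suc_le)
  have step_less: "survival_step p (Suc n) (Suc a) b < survival_step p n (Suc a) b"
    if "(a \<le> n \<and> even (n + a)) \<or> (Suc b \<le> n \<and> even (n + Suc b))" for a b
    using that Suc.IH[of a "Suc b"] by simp
  \<comment> \<open>Only the end at distance \<open>a\<close> is treated; the conclusion is
    symmetric, so exchanging \<open>a\<close> and \<open>b\<close> covers the other end.\<close>
  have "survival_step p (Suc n) a b < survival_step p n a b \<or>
        survival_step p (Suc n) b a < survival_step p n b a"
    if "a \<le> Suc n \<and> even (Suc n + a)" "0 < a + b" for a b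
  proof (cases a)
    case 0
    with that obtain b' where "b = Suc b'" by (cases b) auto
    \<comment> \<open>At the end itself the walk has to turn back and is then one site away from it;
      \<open>n\<close> is odd here, hence at least \<open>1\<close>.\<close>
    moreover have "Suc a \<le> n \<and> even (n + Suc a)" using 0 that by (cases n) auto
    ultimately show ?thesis using step_less[of b' a] by blast
  next
    case (Suc a')
    then show ?thesis using that step_less[of a' b] by auto
  qed
  from this[of a b] this[of b a] Suc.prems
  have "survival_step p (Suc n) a b < survival_step p n a b \<or>
        survival_step p (Suc n) b a < survival_step p n b a"
    unfolding add.commute[of b a] by blast
  then show ?case by (intro survival_Suc_lessI step_le)
qed

text \<open>The end at distance \<open>b\<close> is out of reach, so only the distance to the other end matters.\<close>

lemma survival_shift_le:
  assumes "n < Suc b"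
  shows "survival p (Suc n) a (Suc b) \<le> survival p n (Suc a) b \<and>
    survival p (Suc n) (Suc b) a \<le> survival p n b (Suc a)"
  using assms
proof (induction n arbitrary: a b)
  case 0
  show ?case using survival_le_1 by simp
next
  case (Suc n)
  then obtain b' where b: "b = Suc b'" "n < Suc b'" by (cases b) auto
  \<comment> \<open>If \<open>a = 0\<close>, the walk on the left is killed while the one on the
    right is still on the path.\<close>
  have near: "survival_step p (Suc n) a (Suc b) \<le> survival_step p n (Suc a) b"
    using Suc.IH[of "Suc b"] Suc.prems by (cases a) (auto simp: survival_nonneg)
  \<comment> \<open>Here \<open>b\<close> and the number of moves drop together, so the far end
    stays out of reach.\<close>
  have far: "survival_step p (Suc n) (Suc b) a \<le> survival_step p n b (Suc a)"
    using Suc.IH[of b' "Suc a"] b by simp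
  \<comment> \<open>A reversal exchanges the two directions, so the same two comparisons give both
    conjuncts.\<close>
  show ?case using near far by (auto intro: survival_Suc_leI)
qed

text \<open>Strictness comes from the straight route to the near end: at move \<open>a + 1\<close>
  it kills the walk on the left, while the one on the right is still on the path and survives with
  positive probability.\<close>

lemma survival_shift_less:
  assumes "n < Suc b" "a < n"
  shows "survival p (Suc n) a (Suc b) < survival p n (Suc a) b \<and>
    survival p (Suc n) (Suc b) a < survival p n b (Suc a)"
  using assms
proof (induction n arbitrary: a b)
  case (Suc n)
  then obtain b' where b: "b = Suc b'" "n < Suc b'" by (cases b) auto
  have near: "survival_step p (Suc n) a (Suc b) < survival_step p n (Suc a) b"
    using Suc.IH[of "Suc b" "a - 1"] Suc.prems by (cases a) (auto simp: survival_pos)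
  have far: "survival_step p (Suc n) (Suc b) a \<le> survival_step p n b (Suc a)"
    using survival_shift_le[of n b' "Suc a"] b by simp
  show ?case using near far by (auto intro: survival_Suc_lessI less_imp_le)
qed simp

end

section \<open>Entries of the Schwarz matrix\<close>

lemma mat_of_rows_list_2:
  "i < 2 \<Longrightarrow> j < 2 \<Longrightarrow>
    mat_of_rows_list 2 [[x, y], [z, w]] $$ (i, j) =
      (if i = 0 then (if j = 0 then x else y) else (if j = 0 then z else w))"
  by (auto simp: mat_of_rows_list_def less_2_cases_iff)

text \<open>\<open>T1\<close> lives in its second column and \<open>T2\<close> in its first, so a
  row meets only the last column of the previous block and the first column of the next. The
  modified boundary blocks differ from them just by the vanishing rows \<open>0\<close> and
  \<open>2 * N - 1\<close>.\<close>

lemma schwarz_T_entry: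
  assumes "2 \<le> N" "r < 2 * N" "c < 2 * N"
  shows "schwarz_T N \<delta> l $$ (r, c) =
    (if r = 0 \<or> r = 2 * N - 1 then 0
     else if c + 1 = 2 * (r div 2) then (if even r then 1 - \<delta> / l else \<delta> / l)
     else if c = 2 * (r div 2) + 2 then (if even r then \<delta> / l else 1 - \<delta> / l)
     else 0)"
proof -
  obtain i s where r: "r = 2 * i + s" and s: "s = 0 \<or> s = 1"
    by (metis mult_div_mod_eq mod2_eq_if)
  obtain j t where c: "c = 2 * j + t" and t: "t = 0 \<or> t = 1"
    by (metis mult_div_mod_eq mod2_eq_if)
  have bounds: "i < N" "j < N" using assms r c s t by auto
  have "schwarz_T N \<delta> l $$ (r, c) = schwarz_block N \<delta> l i j $$ (s, t)"
    using assms r c s t by (auto simp: schwarz_T_def)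
  moreover have "schwarz_block N \<delta> l i j $$ (s, t) =
    (if r = 0 \<or> r = 2 * N - 1 then 0
     else if c + 1 = 2 * i then (if s = 0 then 1 - \<delta> / l else \<delta> / l)
     else if c = 2 * i + 2 then (if s = 0 then \<delta> / l else 1 - \<delta> / l)
     else 0)"
  proof -
    have eqs: "(r = 0) = (i = 0 \<and> s = 0)" "(r = 2 * N - 1) = (i = N - 1 \<and> s = 1)"
      "(c + 1 = 2 * i) = (j + 1 = i \<and> t = 1)" "(c = 2 * i + 2) = (j = i + 1 \<and> t = 0)"
      using r c s t bounds assms(1) by presburger+
    show ?thesis
      unfolding eqs schwarz_block_def
      using s t bounds assms(1) by (auto simp: T1_def T2_def T1_tilde_def T2_tilde_def mat_of_rows_list_2)
  qed
  moreover have "r div 2 = i" "even r = (s = 0)" using r s by auto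
  ultimately show ?thesis by simp
qed

section \<open>Infinity norm and spectral radius of nonnegative matrices\<close>

lemma linf_norm_vec_ge: "i < dim_vec v \<Longrightarrow> \<bar>v $ i\<bar> \<le> linf_norm_vec v"
  unfolding linf_norm_vec_def by (intro Max_ge) auto

lemma linf_norm_vec_attained:
  assumes "0 < dim_vec v"
  obtains i where "i < dim_vec v" "linf_norm_vec v = \<bar>v $ i\<bar>"
proof -
  have "linf_norm_vec v \<in> (\<lambda>i. \<bar>v $ i\<bar>) ` {..<dim_vec v}"
    unfolding linf_norm_vec_def using assms by (intro Max_in) auto
  then show ?thesis using that by auto
qed

text \<open>The triangle inequality in one row. The general field serves both real vectors and
  complex eigenvectors.\<close>

lemma norm_mult_mat_vec_le:
  fixes v :: "'a :: real_normed_field vec"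
  assumes A: "A \<in> carrier_mat m n" and nonneg: "\<And>i j. i < m \<Longrightarrow> j < n \<Longrightarrow> 0 \<le> A $$ (i, j)"
    and v: "v \<in> carrier_vec n" and le: "\<And>j. j < n \<Longrightarrow> norm (v $ j) \<le> c" and i: "i < m"
  shows "norm ((map_mat of_real A *\<^sub>v v) $ i) \<le> (A *\<^sub>v vec n (\<lambda>_. 1)) $ i * c"
proof -
  have "(map_mat of_real A *\<^sub>v v) $ i = (\<Sum>j = 0..<n. of_real (A $$ (i, j)) * v $ j)"
    using A v i by (auto simp: scalar_prod_def intro!: sum.cong)
  also have "norm \<dots> \<le> (\<Sum>j = 0..<n. A $$ (i, j) * c)"
    using nonneg i le by (intro sum_norm_le) (auto simp: norm_mult intro!: mult_mono)
  also have "\<dots> = (A *\<^sub>v vec n (\<lambda>_. 1)) $ i * c"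
    using A i by (auto simp: scalar_prod_def sum_distrib_right intro!: sum.cong)
  finally show ?thesis .
qed

text \<open>By the triangle inequality in each row, the all-ones vector maximises the
  quotient.\<close>

lemma linf_norm_mat_nonneg:
  assumes A: "A \<in> carrier_mat m n" and nonneg: "\<And>i j. i < m \<Longrightarrow> j < n \<Longrightarrow> 0 \<le> A $$ (i, j)"
    and pos: "0 < m" "0 < n"
  shows "linf_norm_mat A = linf_norm_vec (A *\<^sub>v vec n (\<lambda>_. 1))"
  unfolding linf_norm_mat_def
proof (rule cSup_eq_maximum)
  let ?e = "vec n (\<lambda>_. 1 :: real)"
  obtain i where "i < n" "linf_norm_vec ?e = \<bar>?e $ i\<bar>"
    using pos by (metis linf_norm_vec_attained dim_vec)
  then have "linf_norm_vec ?e = 1" by simp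
  moreover have "?e \<noteq> 0\<^sub>v n"
    using pos by (metis index_vec index_zero_vec(1) zero_neq_one)
  ultimately show "linf_norm_vec (A *\<^sub>v ?e) \<in>
    {linf_norm_vec (A *\<^sub>v v) / linf_norm_vec v | v. v \<in> carrier_vec (dim_col A) \<and> v \<noteq> 0\<^sub>v (dim_col A)}"
    using A by (auto intro!: exI[of _ ?e])
next
  let ?e = "vec n (\<lambda>_. 1 :: real)"
  fix q assume "q \<in> {linf_norm_vec (A *\<^sub>v v) / linf_norm_vec v | v.
    v \<in> carrier_vec (dim_col A) \<and> v \<noteq> 0\<^sub>v (dim_col A)}"
  then obtain v where v: "v \<in> carrier_vec n" "v \<noteq> 0\<^sub>v n"
    and q: "q = linf_norm_vec (A *\<^sub>v v) / linf_norm_vec v"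
    using A by auto
  from v obtain k where k: "k < n" "v $ k \<noteq> 0" by (metis carrier_vecD eq_vecI index_zero_vec)
  then have v_pos: "0 < linf_norm_vec v" using linf_norm_vec_ge[of k v] v by auto
  obtain i where i: "i < m" "linf_norm_vec (A *\<^sub>v v) = \<bar>(A *\<^sub>v v) $ i\<bar>"
    using A pos by (metis linf_norm_vec_attained dim_mult_mat_vec carrier_matD(1))
  have "map_mat of_real A = A" by (intro eq_matI) auto
  then have "\<bar>(A *\<^sub>v v) $ i\<bar> \<le> (A *\<^sub>v ?e) $ i * linf_norm_vec v"
    using norm_mult_mat_vec_le[of A m n v "linf_norm_vec v" i] A nonneg v i linf_norm_vec_ge[of _ v]
    by simp
  also have "\<dots> \<le> linf_norm_vec (A *\<^sub>v ?e) * linf_norm_vec v"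
    using linf_norm_vec_ge[of i "A *\<^sub>v ?e"] A i v_pos by (intro mult_right_mono) auto
  finally show "q \<le> linf_norm_vec (A *\<^sub>v ?e)"
    unfolding q i(2) using v_pos by (simp add: pos_divide_le_eq)
qed

lemma pow_mat_nonneg:
  fixes A :: "real mat"
  assumes A: "A \<in> carrier_mat n n" and nonneg: "\<And>i j. i < n \<Longrightarrow> j < n \<Longrightarrow> 0 \<le> A $$ (i, j)"
    and "i < n" "j < n"
  shows "0 \<le> (A ^\<^sub>m k) $$ (i, j)"
  using assms(3,4)
proof (induction k arbitrary: i j)
  case (Suc k)
  have "(A ^\<^sub>m Suc k) $$ (i, j) = (\<Sum>m = 0..<n. (A ^\<^sub>m k) $$ (i, m) * A $$ (m, j))"
    using A Suc.prems by (auto simp: scalar_prod_def intro!: sum.cong)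
  then show ?case using Suc nonneg by (auto intro!: sum_nonneg)
qed (use A in auto)

text \<open>Matrix powers grow by a factor on the right, but the recursion for
  \<open>survival\<close> conditions on the first move, which is the leftmost factor.\<close>

lemma pow_mat_Suc_mult_vec:
  fixes A :: "'a :: comm_semiring_1 mat"
  assumes A: "A \<in> carrier_mat n n" and v: "v \<in> carrier_vec n"
  shows "(A ^\<^sub>m Suc k) *\<^sub>v v = A *\<^sub>v ((A ^\<^sub>m k) *\<^sub>v v)"
proof -
  have "A ^\<^sub>m Suc k = A * A ^\<^sub>m k"
  proof (induction k)
    case (Suc k)
    have "A ^\<^sub>m Suc (Suc k) = (A * A ^\<^sub>m k) * A" using Suc by simp
    also have "\<dots> = A * A ^\<^sub>m Suc k" using A by (simp add: assoc_mult_mat[of _ n n _ n _ n])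
    finally show ?case .
  qed (use A in simp)
  then show ?thesis using A v by (simp add: assoc_mult_mat_vec[of _ n n _ n])
qed

text \<open>For an eigenvector of an eigenvalue \<open>ev\<close> of largest modulus, the row of its
  largest entry gives \<open>norm ev ^ k < 1\<close>.\<close>

lemma spectral_radius_less_1:
  assumes A: "A \<in> carrier_mat n n" and nonneg: "\<And>i j. i < n \<Longrightarrow> j < n \<Longrightarrow> 0 \<le> A $$ (i, j)"
    and "0 < n" and less: "linf_norm_vec ((A ^\<^sub>m k) *\<^sub>v vec n (\<lambda>_. 1)) < 1"
  shows "spectral_radius (map_mat complex_of_real A) < 1"
proof -
  let ?B = "map_mat complex_of_real A"
  have B: "?B \<in> carrier_mat n n" using A by simp
  from spectral_radius_mem_max(1)[OF B \<open>0 < n\<close>] obtain ev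
    where ev: "ev \<in> spectrum ?B" "spectral_radius ?B = norm ev" by auto
  then obtain v where ev': "eigenvector ?B v ev" by (auto simp: spectrum_def eigenvalue_def)
  then have v: "v \<in> carrier_vec n" "v \<noteq> 0\<^sub>v n" using B by (auto simp: eigenvector_def)
  \<comment> \<open>The infinity norm of the complex vector \<open>v\<close>;
    \<open>linf_norm_vec\<close> covers real vectors only.\<close>
  define c where "c = Max ((\<lambda>i. norm (v $ i)) ` {..<n})"
  have "c \<in> (\<lambda>i. norm (v $ i)) ` {..<n}"
    unfolding c_def using \<open>0 < n\<close> by (intro Max_in) auto
  then obtain i where i: "i < n" "c = norm (v $ i)" by auto
  have le: "norm (v $ j) \<le> c" if "j < n" for j
    unfolding c_def using that by (intro Max_ge) auto
  from v obtain j where "j < n" "v $ j \<noteq> 0" by (metis carrier_vecD eq_vecI index_zero_vec)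
  then have c_pos: "0 < c" using le[of j] by (meson less_le_trans zero_less_norm_iff)
  have "norm ev ^ k * c = norm ((ev ^ k \<cdot>\<^sub>v v) $ i)"
    using i v by (simp add: norm_mult norm_power)
  also have "ev ^ k \<cdot>\<^sub>v v = map_mat complex_of_real (A ^\<^sub>m k) *\<^sub>v v"
    using eigenvector_pow[OF B ev'] of_real_hom.mat_hom_pow[OF A] by metis
  also have "norm (\<dots> $ i) \<le> ((A ^\<^sub>m k) *\<^sub>v vec n (\<lambda>_. 1)) $ i * c"
    using A nonneg v le i by (intro norm_mult_mat_vec_le) (auto intro!: pow_mat_nonneg)
  also have "\<dots> \<le> linf_norm_vec ((A ^\<^sub>m k) *\<^sub>v vec n (\<lambda>_. 1)) * c"
    using linf_norm_vec_ge[of i "(A ^\<^sub>m k) *\<^sub>v vec n (\<lambda>_. 1)"] A i c_pos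
    by (intro mult_right_mono) auto
  also have "\<dots> < 1 * c" using less c_pos by (rule mult_strict_right_mono)
  finally have "norm ev ^ k < 1" using c_pos by simp
  then have "norm ev < 1" by (meson linorder_not_le one_le_power)
  then show ?thesis using ev by simp
qed

section \<open>Powers of the Schwarz matrix applied to the all-ones vector\<close>

lemma schwarz_T_carrier: "schwarz_T N \<delta> l \<in> carrier_mat (2 * N) (2 * N)"
  by (simp add: schwarz_T_def)

lemma schwarz_T_dim [simp]:
  "dim_row (schwarz_T N \<delta> l) = 2 * N" "dim_col (schwarz_T N \<delta> l) = 2 * N"
  by (simp_all add: schwarz_T_def)

lemma schwarz_T_mult_vec:
  assumes "2 \<le> N" "r < 2 * N" "w \<in> carrier_vec (2 * N)"
  shows "(schwarz_T N \<delta> l *\<^sub>v w) $ r =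
    (if r = 0 \<or> r = 2 * N - 1 then 0
     else (if r div 2 = 0 then 0 else
             (if even r then 1 - \<delta> / l else \<delta> / l) * w $ (2 * (r div 2) - 1)) +
          (if r div 2 + 1 = N then 0 else
             (if even r then \<delta> / l else 1 - \<delta> / l) * w $ (2 * (r div 2) + 2)))"
proof -
  define i where "i = r div 2"
  define x where "x = (if even r then 1 - \<delta> / l else \<delta> / l)"
  define y where "y = (if even r then \<delta> / l else 1 - \<delta> / l)"
  have i: "i < N" using assms by (auto simp: i_def)
  have "(schwarz_T N \<delta> l *\<^sub>v w) $ r = (\<Sum>c = 0..<2 * N. schwarz_T N \<delta> l $$ (r, c) * w $ c)"
    using assms schwarz_T_carrier[of N \<delta> l] by (auto simp: scalar_prod_def intro!: sum.cong)
  \<comment> \<open>For \<open>i = 0\<close> truncated subtraction turns \<open>2 * i - 1\<close>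
    into column \<open>0\<close>, hence the inner test; in the last block \<open>2 * i + 2\<close>
    lies outside the range of summation.\<close>
  also have "\<dots> = (\<Sum>c = 0..<2 * N. if r = 0 \<or> r = 2 * N - 1 then 0 else
      (if c = 2 * i - 1 then (if i = 0 then 0 else x * w $ c) else 0) +
      (if c = 2 * i + 2 then y * w $ c else 0))"
    using assms by (intro sum.cong) (auto simp: schwarz_T_entry i_def x_def y_def)
  also have "\<dots> = (if r = 0 \<or> r = 2 * N - 1 then 0
     else (if i = 0 then 0 else x * w $ (2 * i - 1)) +
          (if i + 1 = N then 0 else y * w $ (2 * i + 2)))"
    using i by (auto simp: sum.distrib)
  finally show ?thesis unfolding i_def x_def y_def .
qed

text \<open>Even rows are sites entered by a move to the right, odd rows sites entered by a move to
  the left. Rows \<open>0\<close> and \<open>2 * N - 1\<close> would be entered from outside the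
  path; there the matrix vanishes although \<open>survival\<close> does not.\<close>

lemma schwarz_T_pow_ones:
  assumes "2 \<le> N" "r < 2 * N"
  shows "((schwarz_T N \<delta> l ^\<^sub>m n) *\<^sub>v ones_vec N) $ r =
    (if 0 < n \<and> (r = 0 \<or> r = 2 * N - 1) then 0
     else if even r then survival (\<delta> / l) n (N - 1 - r div 2) (r div 2)
     else survival (\<delta> / l) n (r div 2) (N - 1 - r div 2))"
  using assms(2)
proof (induction n arbitrary: r)
  case 0
  then show ?case using schwarz_T_carrier[of N \<delta> l] by (simp add: ones_vec_def)
next
  case (Suc n)
  let ?w = "(schwarz_T N \<delta> l ^\<^sub>m n) *\<^sub>v ones_vec N"
  define i where "i = r div 2"
  have i: "i < N" using Suc.prems by (simp add: i_def)
  \<comment> \<open>A move to the left arrives in the odd row of block \<open>i - 1\<close>, one to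
    the right in the even row of block \<open>i + 1\<close>; neither is a vanishing row.\<close>
  have left: "?w $ (2 * i - 1) = survival_step (\<delta> / l) n i (N - 1 - i)" if nz: "i \<noteq> 0"
  proof -
    obtain i' where i': "i = Suc i'" using nz by (cases i) auto
    have "Suc (N - Suc (Suc i')) = N - Suc i'" "Suc (2 * i') \<noteq> 2 * N - Suc 0"
      using i i' by linarith+
    then show ?thesis using Suc.IH[of "2 * i - 1"] i i' by simp
  qed
  have right: "?w $ (2 * i + 2) = survival_step (\<delta> / l) n (N - 1 - i) i" if last: "i + 1 \<noteq> N"
  proof -
    obtain a where a: "N - 1 - i = Suc a" using last i by (cases "N - 1 - i") auto
    then have "N - Suc (Suc i) = a" "Suc (Suc (2 * i)) \<noteq> 2 * N - Suc 0"
      using last i by linarith+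
    then show ?thesis using Suc.IH[of "2 * i + 2"] i last a by simp
  qed
  have "((schwarz_T N \<delta> l ^\<^sub>m Suc n) *\<^sub>v ones_vec N) $ r = (schwarz_T N \<delta> l *\<^sub>v ?w) $ r"
    using pow_mat_Suc_mult_vec[OF schwarz_T_carrier] by (simp add: ones_vec_def)
  also have "\<dots> = (if r = 0 \<or> r = 2 * N - 1 then 0
     else (if even r then 1 - \<delta> / l else \<delta> / l) * survival_step (\<delta> / l) n i (N - 1 - i) +
          (if even r then \<delta> / l else 1 - \<delta> / l) * survival_step (\<delta> / l) n (N - 1 - i) i)"
  proof -
    have "?w \<in> carrier_vec (2 * N)"
      using schwarz_T_carrier[of N \<delta> l] by (simp add: carrier_vecI)
    note mult = schwarz_T_mult_vec[OF assms(1) Suc.prems this, folded i_def]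
    show ?thesis unfolding mult using left right by auto
  qed
  also have "\<dots> = (if 0 < Suc n \<and> (r = 0 \<or> r = 2 * N - 1) then 0
     else if even r then survival (\<delta> / l) (Suc n) (N - 1 - i) i
     else survival (\<delta> / l) (Suc n) i (N - 1 - i))"
    by (simp add: survival_Suc)
  finally show ?case unfolding i_def .
qed

section \<open>Norms of the powers and their strict decrease\<close>

context
  fixes N :: nat and \<delta> l :: real
  assumes N: "2 \<le> N" and delta: "0 < \<delta>" "\<delta> < l"
begin

lemma ratio_bounds: "0 < \<delta> / l" "\<delta> / l < 1"
  using delta by auto

text \<open>By reflection symmetry the odd rows represent all states; \<open>0 < b\<close> avoids
  the vanishing last row.\<close>

lemma survival_le_linf_norm:
  assumes "a + b + 1 = N" "0 < b"
  shows "survival (\<delta> / l) n a b \<le> linf_norm_vec ((schwarz_T N \<delta> l ^\<^sub>m n) *\<^sub>v ones_vec N)"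
proof -
  have r: "2 * a + 1 < 2 * N" "2 * a + 1 \<noteq> 2 * N - 1" "N - 1 - a = b" using assms by auto
  then have "((schwarz_T N \<delta> l ^\<^sub>m n) *\<^sub>v ones_vec N) $ (2 * a + 1) = survival (\<delta> / l) n a b"
    using schwarz_T_pow_ones[OF N r(1), of \<delta> l n] by (simp del: index_mult_mat_vec)
  then show ?thesis
    using linf_norm_vec_ge[of "2 * a + 1" "(schwarz_T N \<delta> l ^\<^sub>m n) *\<^sub>v ones_vec N"] r(1)
    by (simp del: index_mult_mat_vec)
qed

text \<open>Together with \<open>survival_le_linf_norm\<close> this makes the norm the maximum of
  \<open>survival\<close> over the states with \<open>0 < b\<close>.\<close>

lemma linf_norm_survival:
  assumes "1 \<le> n"
  obtains a b where "a + b + 1 = N" "0 < b"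
    "linf_norm_vec ((schwarz_T N \<delta> l ^\<^sub>m n) *\<^sub>v ones_vec N) = survival (\<delta> / l) n a b"
proof -
  let ?w = "(schwarz_T N \<delta> l ^\<^sub>m n) *\<^sub>v ones_vec N"
  have "0 < dim_vec ?w" using N by simp
  then obtain r where "r < dim_vec ?w" and r_max: "linf_norm_vec ?w = \<bar>?w $ r\<bar>"
    by (rule linf_norm_vec_attained)
  then have r: "r < 2 * N" by simp
  \<comment> \<open>This state has positive survival probability, so the maximum is not attained in
    a vanishing row.\<close>
  have "N - 2 + 1 + 1 = N" using N by simp
  from survival_le_linf_norm[OF this, of n] survival_pos[OF ratio_bounds, of "N - 2" 1 n]
  have "0 < linf_norm_vec ?w" by linarith
  moreover have "?w $ r = 0" if "r = 0 \<or> r = 2 * N - 1"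
    using that assms by (subst schwarz_T_pow_ones[OF N r]) simp
  ultimately have ends: "r \<noteq> 0" "r \<noteq> 2 * N - 1" using r_max by linarith+
  show ?thesis
  proof (cases "even r")
    case True
    have "r div 2 < N" using r by simp
    with True show ?thesis
      using r_max ends schwarz_T_pow_ones[OF N r, of \<delta> l n] survival_nonneg[OF ratio_bounds]
      by (intro that[of "N - 1 - r div 2" "r div 2"]) auto
  next
    case False
    then have "Suc (r div 2) < N" using r ends by presburger
    with False show ?thesis
      using r_max ends schwarz_T_pow_ones[OF N r, of \<delta> l n] survival_nonneg[OF ratio_bounds]
      by (intro that[of "r div 2" "N - 1 - r div 2"]) auto
  qed
qed

lemma schwarz_T_nonneg:
  "r < 2 * N \<Longrightarrow> c < 2 * N \<Longrightarrow> 0 \<le> schwarz_T N \<delta> l $$ (r, c)"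
  using N ratio_bounds by (simp add: schwarz_T_entry)

lemma linf_norm_schwarz_T_pow:
  "linf_norm_mat (schwarz_T N \<delta> l ^\<^sub>m n) = linf_norm_vec ((schwarz_T N \<delta> l ^\<^sub>m n) *\<^sub>v ones_vec N)"
  unfolding ones_vec_def using N
  by (intro linf_norm_mat_nonneg[OF pow_carrier_mat[OF schwarz_T_carrier]]
      pow_mat_nonneg[OF schwarz_T_carrier] schwarz_T_nonneg) auto

lemma linf_norm_le_1:
  assumes "1 \<le> n"
  shows "linf_norm_vec ((schwarz_T N \<delta> l ^\<^sub>m n) *\<^sub>v ones_vec N) \<le> 1"
  using linf_norm_survival[OF assms] survival_le_1[OF ratio_bounds] by metis

text \<open>The nearer end is at distance at most \<open>(N - 1) / 2\<close>, which is less than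
  \<open>n\<close>.\<close>

lemma linf_norm_less_1:
  assumes "N \<le> 2 * n"
  shows "linf_norm_vec ((schwarz_T N \<delta> l ^\<^sub>m n) *\<^sub>v ones_vec N) < 1"
proof -
  have "1 \<le> n" using assms N by simp
  from linf_norm_survival[OF this] obtain a b where ab: "a + b + 1 = N"
    "linf_norm_vec ((schwarz_T N \<delta> l ^\<^sub>m n) *\<^sub>v ones_vec N) = survival (\<delta> / l) n a b" .
  then have "a < n \<or> b < n" using assms by linarith
  then show ?thesis using ab survival_less_1[OF ratio_bounds] by simp
qed

lemma linf_norm_decreasing_even:
  assumes n: "N \<le> 2 * n" and "even N"
  shows "linf_norm_vec ((schwarz_T N \<delta> l ^\<^sub>m Suc n) *\<^sub>v ones_vec N) <
    linf_norm_vec ((schwarz_T N \<delta> l ^\<^sub>m n) *\<^sub>v ones_vec N)"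
proof -
  obtain a b where ab: "a + b + 1 = N" "0 < b"
    and eq: "linf_norm_vec ((schwarz_T N \<delta> l ^\<^sub>m Suc n) *\<^sub>v ones_vec N) = survival (\<delta> / l) (Suc n) a b"
    using linf_norm_survival[of "Suc n"] by auto
  \<comment> \<open>Since \<open>a + b = N - 1\<close> is odd, the two distances have opposite
    parities.\<close>
  have parity: "even (n + a) \<or> even (n + b)" using ab(1) \<open>even N\<close> by presburger
  have "\<exists>a' b'. a' + b' + 1 = N \<and> 0 < b' \<and>
    survival (\<delta> / l) (Suc n) a b < survival (\<delta> / l) n a' b'"
  proof (cases "(a \<le> n \<and> even (n + a)) \<or> (b \<le> n \<and> even (n + b))")
    case True
    then show ?thesis using survival_Suc_less[OF ratio_bounds, of a b n] ab by auto
  next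
    case False
    \<comment> \<open>The end of matching parity is more than \<open>n\<close> moves away, so by
      \<open>N \<le> 2 * n\<close> the other one is closer than \<open>n\<close> and the strict
      shift applies.\<close>
    with parity consider "n < a" | "n < b" by force
    then show ?thesis
    proof cases
      case 1
      then obtain a' where a': "a = Suc a'" by (cases a) auto
      have "survival (\<delta> / l) (Suc n) (Suc a') b < survival (\<delta> / l) n a' (Suc b)"
        using survival_shift_less[OF ratio_bounds, of n a' b] 1 a' ab n by auto
      then show ?thesis using a' ab by (intro exI[of _ a'] exI[of _ "Suc b"]) auto
    next
      case 2
      then obtain b' where b': "b = Suc b'" by (cases b) auto
      have "survival (\<delta> / l) (Suc n) a (Suc b') < survival (\<delta> / l) n (Suc a) b'"
        using survival_shift_less[OF ratio_bounds, of n b' a] 2 b' ab n by auto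
      \<comment> \<open>The new state is admissible: \<open>b > n\<close> and
        \<open>n \<ge> 1\<close> leave \<open>b'\<close> positive.\<close>
      then show ?thesis using b' ab 2 n N by (intro exI[of _ "Suc a"] exI[of _ b']) auto
    qed
  qed
  then obtain a' b' where ab': "a' + b' + 1 = N" "0 < b'"
    and less: "survival (\<delta> / l) (Suc n) a b < survival (\<delta> / l) n a' b'"
    by blast
  show ?thesis unfolding eq by (rule less_le_trans[OF less survival_le_linf_norm[OF ab']])
qed

lemma linf_norm_decreasing_odd:
  assumes n: "N \<le> 2 * n" and "odd N"
  shows "linf_norm_vec ((schwarz_T N \<delta> l ^\<^sub>m Suc (Suc n)) *\<^sub>v ones_vec N) <
    linf_norm_vec ((schwarz_T N \<delta> l ^\<^sub>m n) *\<^sub>v ones_vec N)"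
proof -
  obtain a b where ab: "a + b + 1 = N" "0 < b"
    and eq: "linf_norm_vec ((schwarz_T N \<delta> l ^\<^sub>m Suc (Suc n)) *\<^sub>v ones_vec N) =
      survival (\<delta> / l) (Suc (Suc n)) a b"
    using linf_norm_survival[of "Suc (Suc n)"] by auto
  have near: "a \<le> n \<or> b \<le> n" using ab n by linarith
  \<comment> \<open>Now \<open>a + b\<close> is even, so both distances have the same parity and the
    nearer end forces a strict drop in one of the two steps.\<close>
  have parity: "even (n + b) = even (n + a)" using ab(1) \<open>odd N\<close> by presburger
  have "survival (\<delta> / l) (Suc (Suc n)) a b < survival (\<delta> / l) n a b"
  proof (cases "even (n + a)")
    case True
    then have "survival (\<delta> / l) (Suc n) a b < survival (\<delta> / l) n a b"
      using near parity ab by (intro survival_Suc_less[OF ratio_bounds]) auto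
    then show ?thesis using survival_Suc_le[OF ratio_bounds, of "Suc n" a b] by simp
  next
    case False
    then have "survival (\<delta> / l) (Suc (Suc n)) a b < survival (\<delta> / l) (Suc n) a b"
      using near parity ab by (intro survival_Suc_less[OF ratio_bounds]) auto
    then show ?thesis using survival_Suc_le[OF ratio_bounds, of n a b] by simp
  qed
  then show ?thesis unfolding eq using survival_le_linf_norm[OF ab, of n] by simp
qed

end

theorem theorem1:
  fixes N :: nat and \<delta> l :: real
  assumes "N \<ge> 2" and "0 < \<delta>" and "\<delta> < l"
  shows "(\<forall>n::nat. n \<ge> 1 \<longrightarrow>
            linf_norm_mat (schwarz_T N \<delta> l ^\<^sub>m n)
              = linf_norm_vec ((schwarz_T N \<delta> l ^\<^sub>m n) *\<^sub>v ones_vec N)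
          \<and> linf_norm_vec ((schwarz_T N \<delta> l ^\<^sub>m n) *\<^sub>v ones_vec N) \<le> 1)
       \<and> (linf_norm_mat (schwarz_T N \<delta> l ^\<^sub>m nat \<lceil>real N / 2\<rceil>) < 1
          \<and> spectral_radius (map_mat complex_of_real (schwarz_T N \<delta> l)) < 1)
       \<and> (\<forall>n::nat. n \<ge> nat \<lceil>real N / 2\<rceil> \<longrightarrow>
            (even N \<longrightarrow> linf_norm_mat (schwarz_T N \<delta> l ^\<^sub>m (n + 1))
                          < linf_norm_mat (schwarz_T N \<delta> l ^\<^sub>m n))
          \<and> (odd N \<longrightarrow> linf_norm_mat (schwarz_T N \<delta> l ^\<^sub>m (n + 2))
                          < linf_norm_mat (schwarz_T N \<delta> l ^\<^sub>m n)))"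
proof -
  let ?T = "schwarz_T N \<delta> l" and ?K = "nat \<lceil>real N / 2\<rceil>"
  have K: "N \<le> 2 * n" if "?K \<le> n" for n
  proof -
    have "real N / 2 \<le> real n" using real_nat_ceiling_ge[of "real N / 2"] that by linarith
    then show ?thesis by linarith
  qed
  have "spectral_radius (map_mat complex_of_real ?T) < 1"
    using assms(1) linf_norm_less_1[OF assms K[OF order_refl]] schwarz_T_nonneg[OF assms]
    by (intro spectral_radius_less_1[OF schwarz_T_carrier]) (auto simp: ones_vec_def)
  then show ?thesis
    using linf_norm_le_1[OF assms] linf_norm_less_1[OF assms K[OF order_refl]]
      linf_norm_decreasing_even[OF assms K] linf_norm_decreasing_odd[OF assms K]
    by (simp add: linf_norm_schwarz_T_pow[OF assms] del: pow_mat.simps)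
qed

end
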